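(* Let $G$ be an $n$-dimensional non-unimodular Lie group with a left-invariant pseudo-Riemannian metric $\langle\cdot,\cdot\rangle$ of signature $(p,q)$, and let $\mathfrak{g}$ be the (non-unimodular) Lie algebra of left-invariant vector fields on $G$. If there is an $X\in\mathfrak{g}$ which is a non-Killing conformal vector field, then $\dim C(\mathfrak{g})\leq\min(p,q)$ and $\dim[\mathfrak{g},\mathfrak{g}]\geq\dim\mathfrak{g}-\min(p,q)$.
   Context: A Lie group $G$ with Lie algebra $\mathfrak{g}$ of left-invariant vector fields is called unimodular if $\mathrm{tr}(\mathrm{ad}_X)=0$ for every $X\in\mathfrak{g}$, where $\mathrm{ad}_X(Y)=[X,Y]$; otherwise it is non-unimodular. A metric on $G$ is left-invariant if all left translations are isometries; signature $(p,q)$ means $p$ positive and $q$ negative directions, $p+q=n$. $C(\mathfrak{g})=\{X\in\mathfrak{g}:\mathrm{ad}_X=0\}$ is the center and $[\mathfrak{g},\mathfrak{g}]$ is the commutator ideal (the linear span of all brackets). A vector field $X$ is conformal if $\mathfrak{L}_X\langle\cdot,\cdot\rangle=2\rho\langle\cdot,\cdot\rangle$ for some smooth function $\rho$ on $G$, where $\mathfrak{L}_X$ is the Lie derivative, $(\mathfrak{L}_X\langle\cdot,\cdot\rangle)(Y,Z)=X\langle Y,Z\rangle-\langle[X,Y],Z\rangle-\langle Y,[X,Z]\rangle$. A vector field $X$ is Killing if $\mathfrak{L}_X\langle\cdot,\cdot\rangle=0$. *)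

theory Defs
  imports "HOL-Analysis.Analysis" "HOL-Library.Function_Algebras"
begin

instantiation "fun" :: (type, real_vector) real_vector
begin

definition scaleR_fun :: "real \<Rightarrow> ('a \<Rightarrow> 'b) \<Rightarrow> 'a \<Rightarrow> 'b"
  where "scaleR_fun c f = (\<lambda>x. c *\<^sub>R f x)"

instance
  by standard (auto simp: scaleR_fun_def fun_eq_iff scaleR_add_right scaleR_add_left)

end

section \<open>Smooth manifolds given by an atlas\<close>

text \<open>Intended for open \<open>S\<close> in a finite-dimensional space, where existence and continuity of
  all iterated directional derivatives gives the usual class \<open>C\<^sup>k\<close>.\<close>

primrec C_k_on :: "nat \<Rightarrow> 'a::real_normed_vector set \<Rightarrow> ('a \<Rightarrow> 'b::real_normed_vector) \<Rightarrow> bool"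
  where
    "C_k_on 0 S f \<longleftrightarrow> continuous_on S f"
  | "C_k_on (Suc k) S f \<longleftrightarrow>
      (\<forall>x\<in>S. f differentiable (at x)) \<and> (\<forall>v. C_k_on k S (\<lambda>x. frechet_derivative f (at x) v))"

definition smooth_on :: "'a::real_normed_vector set \<Rightarrow> ('a \<Rightarrow> 'b::real_normed_vector) \<Rightarrow> bool"
  where "smooth_on S f \<longleftrightarrow> (\<forall>k. C_k_on k S f)"

text \<open>A chart \<open>(U, \<phi>)\<close> is a homeomorphism of the open set \<open>U\<close> onto an open subset of the model
  space; values of \<open>\<phi>\<close> outside \<open>U\<close> are irrelevant.  The underlying set of a manifold is
  the whole type. Atlases are not required to be maximal: all notions below depend only on the
  smooth structure the atlas generates.\<close>

type_synonym ('m, 'e) atlas = "('m set \<times> ('m \<Rightarrow> 'e)) set"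

definition is_chart :: "'m::topological_space set \<times> ('m \<Rightarrow> 'e::euclidean_space) \<Rightarrow> bool"
  where "is_chart = (\<lambda>(U, \<phi>). open U \<and> open (\<phi> ` U) \<and>
    homeomorphism U (\<phi> ` U) \<phi> (inv_into U \<phi>))"

definition smooth_atlas ::
    "('m::{t2_space,second_countable_topology}, 'e::euclidean_space) atlas \<Rightarrow> bool"
  where "smooth_atlas A \<longleftrightarrow>
    (\<forall>c\<in>A. is_chart c) \<and> (\<Union>(U, \<phi>)\<in>A. U) = UNIV \<and>
    (\<forall>(U, \<phi>)\<in>A. \<forall>(V, \<psi>)\<in>A. smooth_on (\<phi> ` (U \<inter> V)) (\<psi> \<circ> inv_into U \<phi>))"

definition prod_atlas ::
    "('m::topological_space, 'e::euclidean_space) atlas \<Rightarrow>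
     ('n::topological_space, 'f::euclidean_space) atlas \<Rightarrow> ('m \<times> 'n, 'e \<times> 'f) atlas"
  where "prod_atlas A B = {(U \<times> V, map_prod \<phi> \<psi>) | U \<phi> V \<psi>. (U, \<phi>) \<in> A \<and> (V, \<psi>) \<in> B}"

definition smooth_map ::
    "('m::topological_space, 'e::euclidean_space) atlas \<Rightarrow>
     ('n::topological_space, 'f::euclidean_space) atlas \<Rightarrow> ('m \<Rightarrow> 'n) \<Rightarrow> bool"
  where "smooth_map A B F \<longleftrightarrow> continuous_on UNIV F \<and>
    (\<forall>(U, \<phi>)\<in>A. \<forall>(V, \<psi>)\<in>B. smooth_on (\<phi> ` (U \<inter> F -` V)) (\<psi> \<circ> F \<circ> inv_into U \<phi>))"

definition smooth_fun ::
    "('m::topological_space, 'e::euclidean_space) atlas \<Rightarrow> ('m \<Rightarrow> real) \<Rightarrow> bool"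
  where "smooth_fun A f \<longleftrightarrow> smooth_map A {(UNIV, id)} f"

section \<open>Tangent vectors and vector fields\<close>

text \<open>Tangent vectors at \<open>x\<close> are derivations at \<open>x\<close> of the algebra of smooth functions. As
  functions in HOL are total, they are normalised to be \<open>0\<close> on non-smooth arguments, which makes
  the representation unique.\<close>

type_synonym 'm tvec = "('m \<Rightarrow> real) \<Rightarrow> real"
type_synonym 'm vfield = "'m \<Rightarrow> 'm tvec"

definition tangent_space ::
    "('m::topological_space, 'e::euclidean_space) atlas \<Rightarrow> 'm \<Rightarrow> 'm tvec set"
  where "tangent_space A x = {v.
    (\<forall>f g. smooth_fun A f \<longrightarrow> smooth_fun A g \<longrightarrow>
       v (f + g) = v f + v g \<and> v (f * g) = f x * v g + g x * v f) \<and>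
    (\<forall>f c. smooth_fun A f \<longrightarrow> v (c *\<^sub>R f) = c * v f) \<and>
    (\<forall>f. \<not> smooth_fun A f \<longrightarrow> v f = 0)}"

definition push_forward ::
    "('m::topological_space, 'e::euclidean_space) atlas \<Rightarrow> ('m \<Rightarrow> 'm) \<Rightarrow> 'm tvec \<Rightarrow> 'm tvec"
  where "push_forward A F v = (\<lambda>f. if smooth_fun A f then v (f \<circ> F) else 0)"

definition smooth_vector_field ::
    "('m::topological_space, 'e::euclidean_space) atlas \<Rightarrow> 'm vfield \<Rightarrow> bool"
  where "smooth_vector_field A X \<longleftrightarrow> (\<forall>x. X x \<in> tangent_space A x) \<and>
    (\<forall>f. smooth_fun A f \<longrightarrow> smooth_fun A (\<lambda>x. X x f))"

definition lie_bracket ::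
    "('m::topological_space, 'e::euclidean_space) atlas \<Rightarrow> 'm vfield \<Rightarrow> 'm vfield \<Rightarrow> 'm vfield"
  where "lie_bracket A X Y = (\<lambda>x f.
    if smooth_fun A f then X x (\<lambda>y. Y y f) - Y x (\<lambda>y. X y f) else 0)"

section \<open>Pseudo-Riemannian metrics\<close>

type_synonym 'm metric_tensor = "'m \<Rightarrow> 'm tvec \<Rightarrow> 'm tvec \<Rightarrow> real"

definition nondegenerate_symmetric_form_on :: "'v::real_vector set \<Rightarrow> ('v \<Rightarrow> 'v \<Rightarrow> real) \<Rightarrow> bool"
  where "nondegenerate_symmetric_form_on V b \<longleftrightarrow>
    (\<forall>u\<in>V. \<forall>v\<in>V. b u v = b v u) \<and>
    (\<forall>u\<in>V. \<forall>v\<in>V. \<forall>w\<in>V. b (u + v) w = b u w + b v w) \<and>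
    (\<forall>c. \<forall>u\<in>V. \<forall>w\<in>V. b (c *\<^sub>R u) w = c * b u w) \<and>
    (\<forall>u\<in>V. (\<forall>w\<in>V. b u w = 0) \<longrightarrow> u = 0)"

definition has_signature_on ::
    "'v::real_vector set \<Rightarrow> ('v \<Rightarrow> 'v \<Rightarrow> real) \<Rightarrow> nat \<Rightarrow> nat \<Rightarrow> bool"
  where "has_signature_on V b p q \<longleftrightarrow> (\<exists>P N.
    finite P \<and> finite N \<and> P \<inter> N = {} \<and> card P = p \<and> card N = q \<and>
    P \<union> N \<subseteq> V \<and> independent (P \<union> N) \<and> V \<subseteq> span (P \<union> N) \<and>
    pairwise (\<lambda>u v. b u v = 0) (P \<union> N) \<and>
    (\<forall>u\<in>P. b u u > 0) \<and> (\<forall>u\<in>N. b u u < 0))"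

text \<open>Values of \<open>h x\<close> outside \<open>tangent_space A x\<close> are irrelevant.\<close>

definition pseudo_riemannian_metric ::
    "('m::topological_space, 'e::euclidean_space) atlas \<Rightarrow> 'm metric_tensor \<Rightarrow> bool"
  where "pseudo_riemannian_metric A h \<longleftrightarrow>
    (\<forall>x. nondegenerate_symmetric_form_on (tangent_space A x) (h x)) \<and>
    (\<forall>Y Z. smooth_vector_field A Y \<longrightarrow> smooth_vector_field A Z \<longrightarrow>
       smooth_fun A (\<lambda>x. h x (Y x) (Z x)))"

definition metric_signature ::
    "('m::topological_space, 'e::euclidean_space) atlas \<Rightarrow> 'm metric_tensor \<Rightarrow> nat \<Rightarrow> nat \<Rightarrow> bool"
  where "metric_signature A h p q \<longleftrightarrow> (\<forall>x. has_signature_on (tangent_space A x) (h x) p q)"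

definition metric_isometry ::
    "('m::topological_space, 'e::euclidean_space) atlas \<Rightarrow> 'm metric_tensor \<Rightarrow> ('m \<Rightarrow> 'm) \<Rightarrow> bool"
  where "metric_isometry A h F \<longleftrightarrow> bij F \<and> smooth_map A A F \<and> smooth_map A A (inv F) \<and>
    (\<forall>x. \<forall>u\<in>tangent_space A x. \<forall>v\<in>tangent_space A x.
       h (F x) (push_forward A F u) (push_forward A F v) = h x u v)"

definition lie_derivative_metric ::
    "('m::topological_space, 'e::euclidean_space) atlas \<Rightarrow> 'm metric_tensor \<Rightarrow>
     'm vfield \<Rightarrow> 'm vfield \<Rightarrow> 'm vfield \<Rightarrow> 'm \<Rightarrow> real"
  where "lie_derivative_metric A h X Y Z = (\<lambda>x.
    X x (\<lambda>y. h y (Y y) (Z y)) - h x (lie_bracket A X Y x) (Z x) - h x (Y x) (lie_bracket A X Z x))"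

definition conformal_field ::
    "('m::topological_space, 'e::euclidean_space) atlas \<Rightarrow> 'm metric_tensor \<Rightarrow> 'm vfield \<Rightarrow> bool"
  where "conformal_field A h X \<longleftrightarrow> smooth_vector_field A X \<and>
    (\<exists>\<rho>. smooth_fun A \<rho> \<and>
      (\<forall>Y Z. smooth_vector_field A Y \<longrightarrow> smooth_vector_field A Z \<longrightarrow>
        (\<forall>x. lie_derivative_metric A h X Y Z x = 2 * \<rho> x * h x (Y x) (Z x))))"

definition killing_field ::
    "('m::topological_space, 'e::euclidean_space) atlas \<Rightarrow> 'm metric_tensor \<Rightarrow> 'm vfield \<Rightarrow> bool"
  where "killing_field A h X \<longleftrightarrow> smooth_vector_field A X \<and>
    (\<forall>Y Z. smooth_vector_field A Y \<longrightarrow> smooth_vector_field A Z \<longrightarrow>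
      (\<forall>x. lie_derivative_metric A h X Y Z x = 0))"

section \<open>Lie groups\<close>

definition lie_group ::
    "('g::{t2_space,second_countable_topology}, 'e::euclidean_space) atlas \<Rightarrow>
     ('g \<Rightarrow> 'g \<Rightarrow> 'g) \<Rightarrow> 'g \<Rightarrow> ('g \<Rightarrow> 'g) \<Rightarrow> bool"
  where "lie_group A mul e iv \<longleftrightarrow> group mul e iv \<and> smooth_atlas A \<and>
    smooth_map (prod_atlas A A) A (\<lambda>(x, y). mul x y) \<and> smooth_map A A iv"

definition left_invariant_metric ::
    "('g::topological_space, 'e::euclidean_space) atlas \<Rightarrow> ('g \<Rightarrow> 'g \<Rightarrow> 'g) \<Rightarrow>
     'g metric_tensor \<Rightarrow> bool"
  where "left_invariant_metric A mul h \<longleftrightarrow> (\<forall>a. metric_isometry A h (mul a))"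

text \<open>The Lie algebra is a linear subspace of \<open>'g vfield\<close> (with the pointwise operations) and carries
  the bracket \<open>lie_bracket A\<close>.\<close>

definition lie_algebra ::
    "('g::topological_space, 'e::euclidean_space) atlas \<Rightarrow> ('g \<Rightarrow> 'g \<Rightarrow> 'g) \<Rightarrow> 'g vfield set"
  where "lie_algebra A mul = {X. smooth_vector_field A X \<and>
    (\<forall>a x. push_forward A (mul a) (X x) = X (mul a x))}"

text \<open>Trace of a linear endomorphism \<open>T\<close> of a finite-dimensional subspace \<open>V\<close>, i.e. the sum of the
  diagonal entries of its matrix; it does not depend on the chosen basis.\<close>

definition trace_on :: "'v::real_vector set \<Rightarrow> ('v \<Rightarrow> 'v) \<Rightarrow> real"
  where "trace_on V T =
    (let B = (SOME B. B \<subseteq> V \<and> independent B \<and> V \<subseteq> span B)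
     in \<Sum>b\<in>B. representation B (T b) b)"

definition unimodular ::
    "('g::topological_space, 'e::euclidean_space) atlas \<Rightarrow> ('g \<Rightarrow> 'g \<Rightarrow> 'g) \<Rightarrow> bool"
  where "unimodular A mul \<longleftrightarrow>
    (\<forall>X\<in>lie_algebra A mul. trace_on (lie_algebra A mul) (lie_bracket A X) = 0)"

definition lie_center ::
    "('g::topological_space, 'e::euclidean_space) atlas \<Rightarrow> ('g \<Rightarrow> 'g \<Rightarrow> 'g) \<Rightarrow> 'g vfield set"
  where "lie_center A mul =
    {X \<in> lie_algebra A mul. \<forall>Y\<in>lie_algebra A mul. lie_bracket A X Y = 0}"

definition commutator_ideal ::
    "('g::topological_space, 'e::euclidean_space) atlas \<Rightarrow> ('g \<Rightarrow> 'g \<Rightarrow> 'g) \<Rightarrow> 'g vfield set"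
  where "commutator_ideal A mul =
    span {lie_bracket A X Y | X Y. X \<in> lie_algebra A mul \<and> Y \<in> lie_algebra A mul}"

end

(* Write g for the Lie algebra and b for the metric. For left-invariant X, Y the function b(Y,Y) is
   constant, so a conformal X satisfies -2 b([X,Y],Y) = 2 rho b(Y,Y), where rho does not vanish at
   some point x0. Hence every Y in g with b([X,Y],Y) = 0 at x0 is null there. This applies to the
   center and to the orthogonal complement of [g,g] in g. Evaluation at x0 is injective on g, so a
   space of null vectors has dimension at most min(p,q), and the complement of [g,g] is cut out by
   dim [g,g] linear conditions. *)
theory Submission
  imports Defs
begin

section \<open>The algebra of smooth functions\<close>

text \<open>On an open set, \<open>frechet_derivative\<close> at a point depends only on the values
  near that point. This allows derivative formulas that hold only on \<open>S\<close> to be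
  substituted before passing to the next order.\<close>

lemma C_k_on_cong:
  assumes "open S" "\<And>x. x \<in> S \<Longrightarrow> f x = g x" "C_k_on k S f"
  shows "C_k_on k S g"
  using assms(2,3)
proof (induction k arbitrary: f g)
  case 0
  then show ?case by (auto cong: continuous_on_cong)
next
  case (Suc k)
  have der: "(g has_derivative frechet_derivative f (at x)) (at x)" if "x \<in> S" for x
  proof (rule has_derivative_transform_within_open[OF _ assms(1) that])
    show "(f has_derivative frechet_derivative f (at x)) (at x)"
      using Suc.prems(2) that frechet_derivative_works by auto
  qed (use Suc.prems(1) in auto)
  have "C_k_on k S (\<lambda>x. frechet_derivative g (at x) v)" for v
  proof (rule Suc.IH)
    show "C_k_on k S (\<lambda>x. frechet_derivative f (at x) v)"
      using Suc.prems(2) by simp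
  qed (use der frechet_derivative_at in metis)
  then show ?case
    using der by (auto intro: differentiableI)
qed

text \<open>At the bottom, differentiability gives continuity. The product rule relies on this
  descent, because its undifferentiated factors are needed one order lower than assumed.\<close>

lemma C_k_on_SucD: "C_k_on (Suc k) S f \<Longrightarrow> C_k_on k S f"
proof (induction k arbitrary: f)
  case 0
  then show ?case
    by (auto intro!: continuous_at_imp_continuous_on differentiable_imp_continuous_within)
next
  case (Suc k)
  then show ?case by (metis C_k_on.simps(2))
qed

lemma C_k_on_add:
  assumes "open S" "C_k_on k S f" "C_k_on k S g"
  shows "C_k_on k S (\<lambda>x. f x + g x)"
  using assms(2,3)
proof (induction k arbitrary: f g)
  case 0
  then show ?case by (auto intro: continuous_on_add)
next
  case (Suc k)
  have "C_k_on k S (\<lambda>x. frechet_derivative (\<lambda>x. f x + g x) (at x) v)" for v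
  proof (rule C_k_on_cong[OF assms(1)])
    show "C_k_on k S (\<lambda>x. frechet_derivative f (at x) v + frechet_derivative g (at x) v)"
      using Suc by simp
    fix x assume "x \<in> S"
    then have "((\<lambda>x. f x + g x) has_derivative
        (\<lambda>v. frechet_derivative f (at x) v + frechet_derivative g (at x) v)) (at x)"
      using Suc.prems by (intro has_derivative_add) (auto simp: frechet_derivative_works[symmetric])
    from frechet_derivative_at[OF this]
    show "frechet_derivative f (at x) v + frechet_derivative g (at x) v
      = frechet_derivative (\<lambda>x. f x + g x) (at x) v" by (rule fun_cong)
  qed
  then show ?case using Suc.prems by (auto intro: differentiable_add)
qed

lemma C_k_on_mult:
  fixes f g :: "'a::real_normed_vector \<Rightarrow> real"
  assumes "open S" "C_k_on k S f" "C_k_on k S g"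
  shows "C_k_on k S (\<lambda>x. f x * g x)"
  using assms(2,3)
proof (induction k arbitrary: f g)
  case 0
  then show ?case by (auto intro: continuous_on_mult)
next
  case (Suc k)
  have "C_k_on k S (\<lambda>x. frechet_derivative (\<lambda>x. f x * g x) (at x) v)" for v
  proof (rule C_k_on_cong[OF assms(1)])
    show "C_k_on k S (\<lambda>x. f x * frechet_derivative g (at x) v + frechet_derivative f (at x) v * g x)"
      using Suc.prems C_k_on_SucD[OF Suc.prems(1)] C_k_on_SucD[OF Suc.prems(2)]
      by (intro C_k_on_add[OF assms(1)] Suc.IH) auto
    fix x assume "x \<in> S"
    then have "((\<lambda>x. f x * g x) has_derivative
        (\<lambda>v. f x * frechet_derivative g (at x) v + frechet_derivative f (at x) v * g x)) (at x)"
      using Suc.prems by (intro has_derivative_mult) (auto simp: frechet_derivative_works[symmetric])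
    from frechet_derivative_at[OF this]
    show "f x * frechet_derivative g (at x) v + frechet_derivative f (at x) v * g x
      = frechet_derivative (\<lambda>x. f x * g x) (at x) v" by (rule fun_cong)
  qed
  then show ?case using Suc.prems by (auto intro: differentiable_mult)
qed

lemma C_k_on_scaleR:
  assumes "open S" "C_k_on k S f"
  shows "C_k_on k S (\<lambda>x. c *\<^sub>R f x)"
  using assms(2)
proof (induction k arbitrary: f)
  case 0
  then show ?case by (auto intro: continuous_intros)
next
  case (Suc k)
  have der: "((\<lambda>x. c *\<^sub>R f x) has_derivative (\<lambda>v. c *\<^sub>R frechet_derivative f (at x) v)) (at x)"
    if "x \<in> S" for x
    using Suc.prems that by (intro has_derivative_scaleR_right) (auto simp: frechet_derivative_works[symmetric])
  have "C_k_on k S (\<lambda>x. frechet_derivative (\<lambda>x. c *\<^sub>R f x) (at x) v)" for v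
  proof (rule C_k_on_cong[OF assms(1)])
    show "C_k_on k S (\<lambda>x. c *\<^sub>R frechet_derivative f (at x) v)"
      using Suc by simp
  qed (use der frechet_derivative_at in metis)
  then show ?case using der by (auto intro: differentiableI)
qed

lemma smooth_fun_iff:
  "smooth_fun A f \<longleftrightarrow> continuous_on UNIV f \<and>
    (\<forall>(U, \<phi>)\<in>A. \<forall>k. C_k_on k (\<phi> ` U) (\<lambda>x. f (inv_into U \<phi> x)))"
  by (simp add: smooth_fun_def smooth_map_def smooth_on_def o_def)

section \<open>Smooth functions on a manifold with a fixed atlas\<close>

locale atlas =
  fixes A :: "('m::{t2_space,second_countable_topology}, 'e::euclidean_space) atlas"
  assumes smooth_atlas: "smooth_atlas A"
begin

lemma open_chart: "(U, \<phi>) \<in> A \<Longrightarrow> open (\<phi> ` U)"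
  using smooth_atlas unfolding smooth_atlas_def is_chart_def by blast

lemma smooth_funI:
  assumes "continuous_on UNIV f"
    and "\<And>U \<phi> k. (U, \<phi>) \<in> A \<Longrightarrow> C_k_on k (\<phi> ` U) (\<lambda>x. f (inv_into U \<phi> x))"
  shows "smooth_fun A f"
  using assms unfolding smooth_fun_iff by blast

lemma smooth_funD:
  assumes "smooth_fun A f"
  shows "continuous_on UNIV f"
    and "(U, \<phi>) \<in> A \<Longrightarrow> C_k_on k (\<phi> ` U) (\<lambda>x. f (inv_into U \<phi> x))"
  using assms unfolding smooth_fun_iff by blast+

lemma smooth_fun_add:
  assumes "smooth_fun A f" "smooth_fun A g"
  shows "smooth_fun A (f + g)"
  unfolding plus_fun_def
proof (rule smooth_funI)
  show "continuous_on UNIV (\<lambda>x. f x + g x)"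
    using assms by (intro continuous_intros smooth_funD)
next
  fix U \<phi> k assume "(U, \<phi>) \<in> A"
  then show "C_k_on k (\<phi> ` U) (\<lambda>x. f (inv_into U \<phi> x) + g (inv_into U \<phi> x))"
    using assms by (intro C_k_on_add open_chart smooth_funD)
qed

lemma smooth_fun_mult:
  assumes "smooth_fun A f" "smooth_fun A g"
  shows "smooth_fun A (f * g)"
  unfolding times_fun_def
proof (rule smooth_funI)
  show "continuous_on UNIV (\<lambda>x. f x * g x)"
    using assms by (intro continuous_intros smooth_funD)
next
  fix U \<phi> k assume "(U, \<phi>) \<in> A"
  then show "C_k_on k (\<phi> ` U) (\<lambda>x. f (inv_into U \<phi> x) * g (inv_into U \<phi> x))"
    using assms by (intro C_k_on_mult open_chart smooth_funD)
qed

lemma smooth_fun_scaleR: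
  assumes "smooth_fun A f"
  shows "smooth_fun A (c *\<^sub>R f)"
  unfolding scaleR_fun_def
proof (rule smooth_funI)
  show "continuous_on UNIV (\<lambda>x. c *\<^sub>R f x)"
    using assms by (intro continuous_intros smooth_funD)
next
  fix U \<phi> k assume "(U, \<phi>) \<in> A"
  then show "C_k_on k (\<phi> ` U) (\<lambda>x. c *\<^sub>R f (inv_into U \<phi> x))"
    using assms by (intro C_k_on_scaleR open_chart smooth_funD)
qed

lemma smooth_fun_diff: "smooth_fun A f \<Longrightarrow> smooth_fun A g \<Longrightarrow> smooth_fun A (f - g)"
  using smooth_fun_add[of f "(-1) *\<^sub>R g"] smooth_fun_scaleR[of g "-1"] by simp

section \<open>Tangent vectors and brackets\<close>

lemma tangent_add:
  "v \<in> tangent_space A x \<Longrightarrow> smooth_fun A f \<Longrightarrow> smooth_fun A g \<Longrightarrow> v (f + g) = v f + v g"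
  and tangent_mult:
  "v \<in> tangent_space A x \<Longrightarrow> smooth_fun A f \<Longrightarrow> smooth_fun A g \<Longrightarrow> v (f * g) = f x * v g + g x * v f"
  and tangent_scaleR:
  "v \<in> tangent_space A x \<Longrightarrow> smooth_fun A f \<Longrightarrow> v (c *\<^sub>R f) = c * v f"
  and tangent_nonsmooth:
  "v \<in> tangent_space A x \<Longrightarrow> \<not> smooth_fun A f \<Longrightarrow> v f = 0"
  by (simp_all add: tangent_space_def)

text \<open>Homogeneity with factor 0 if the zero function is smooth, the normalisation of tangent
  vectors otherwise.\<close>

lemma tangent_zero: "v \<in> tangent_space A x \<Longrightarrow> v 0 = 0"
  using tangent_scaleR[of v x 0 0] tangent_nonsmooth[of v x 0] by force

text \<open>No smooth unit is needed: a constant \<open>f = c\<close> satisfies \<open>f * f = c *\<^sub>R f\<close>,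
  which the Leibniz rule turns into \<open>2 * c * v f = c * v f\<close>.\<close>

lemma tangent_const:
  assumes v: "v \<in> tangent_space A x"
  shows "v (\<lambda>_. c) = 0"
proof (cases "smooth_fun A (\<lambda>_. c)")
  case True
  have "(\<lambda>_. c) * (\<lambda>_. c) = c *\<^sub>R ((\<lambda>_. c) :: 'm \<Rightarrow> real)"
    by (simp add: times_fun_def scaleR_fun_def)
  then have "c * v (\<lambda>_. c) + c * v (\<lambda>_. c) = c * v (\<lambda>_. c)"
    using tangent_mult[OF v True True] tangent_scaleR[OF v True, of c] by simp
  then have "c = 0 \<or> v (\<lambda>_. c) = 0" by simp
  then show ?thesis using tangent_zero[OF v] by (auto simp: zero_fun_def)
qed (use tangent_nonsmooth[OF v] in blast)

lemma subspace_tangent_space: "subspace (tangent_space A x)"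
  by (rule subspaceI) (auto simp: tangent_space_def scaleR_fun_def algebra_simps)

section \<open>Smooth vector fields: linear structure and brackets\<close>

lemma smooth_vector_fieldD:
  assumes "smooth_vector_field A X"
  shows smooth_vector_field_tangent: "X x \<in> tangent_space A x"
    and smooth_vector_field_smooth: "smooth_fun A f \<Longrightarrow> smooth_fun A (\<lambda>x. X x f)"
  using assms by (auto simp: smooth_vector_field_def)

lemma smooth_vector_field_zero: "smooth_vector_field A 0"
proof -
  have "smooth_fun A (\<lambda>x. 0)" if "smooth_fun A f" for f
    using smooth_fun_scaleR[OF that, of 0] by (simp add: zero_fun_def)
  then show ?thesis
    using subspace_0[OF subspace_tangent_space] by (auto simp: smooth_vector_field_def)
qed

lemma smooth_vector_field_add:
  assumes "smooth_vector_field A X" "smooth_vector_field A Y"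
  shows "smooth_vector_field A (X + Y)"
proof -
  have "smooth_fun A (\<lambda>x. X x f + Y x f)" if "smooth_fun A f" for f
    using smooth_fun_add[OF smooth_vector_field_smooth[OF assms(1) that]
        smooth_vector_field_smooth[OF assms(2) that]] by (simp add: plus_fun_def)
  then show ?thesis
    using assms subspace_add[OF subspace_tangent_space]
    by (auto simp: smooth_vector_field_def)
qed

lemma smooth_vector_field_scaleR:
  assumes "smooth_vector_field A X"
  shows "smooth_vector_field A (c *\<^sub>R X)"
proof -
  have "smooth_fun A (\<lambda>x. c * X x f)" if "smooth_fun A f" for f
    using smooth_fun_scaleR[OF smooth_vector_field_smooth[OF assms that], of c]
    by (simp add: scaleR_fun_def)
  moreover have "c *\<^sub>R X x \<in> tangent_space A x" for x
    using assms subspace_scale[OF subspace_tangent_space] by (auto simp: smooth_vector_field_def)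
  ultimately show ?thesis
    by (auto simp: smooth_vector_field_def scaleR_fun_def)
qed

text \<open>The composites of \<open>X\<close> and \<open>Y\<close> in either order violate the
  Leibniz rule by the same terms \<open>X f * Y g + Y f * X g\<close>, which cancel in the
  commutator.\<close>

lemma lie_bracket_tangent:
  assumes X: "smooth_vector_field A X" and Y: "smooth_vector_field A Y"
  shows "lie_bracket A X Y x \<in> tangent_space A x"
proof -
  note t = smooth_vector_field_tangent[OF X] smooth_vector_field_tangent[OF Y]
  note s = smooth_vector_field_smooth[OF X] smooth_vector_field_smooth[OF Y]
  have add: "(\<lambda>y. Z y (f + g)) = (\<lambda>y. Z y f) + (\<lambda>y. Z y g)"
    if "smooth_vector_field A Z" "smooth_fun A f" "smooth_fun A g" for Z f g
    using tangent_add[OF smooth_vector_field_tangent[OF that(1)] that(2,3)] by auto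
  have mult: "(\<lambda>y. Z y (f * g)) = f * (\<lambda>y. Z y g) + g * (\<lambda>y. Z y f)"
    if "smooth_vector_field A Z" "smooth_fun A f" "smooth_fun A g" for Z f g
    using tangent_mult[OF smooth_vector_field_tangent[OF that(1)] that(2,3)]
    by (auto simp: times_fun_def)
  have sc: "(\<lambda>y. Z y (c *\<^sub>R f)) = c *\<^sub>R (\<lambda>y. Z y f)"
    if "smooth_vector_field A Z" "smooth_fun A f" for Z f c
    using tangent_scaleR[OF smooth_vector_field_tangent[OF that(1)] that(2)]
    by (auto simp: scaleR_fun_def)
  \<comment> \<open>The outer derivation acting on the result of the inner Leibniz rule:
    \<open>a\<close> and \<open>b\<close> become the derivatives of \<open>g\<close> and
    \<open>f\<close> along the other field.\<close>
  have leibniz: "v (\<lambda>y. f y * a y + g y * b y) = (f x * v a + a x * v f) + (g x * v b + b x * v g)"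
    if "v \<in> tangent_space A x" "smooth_fun A f" "smooth_fun A a" "smooth_fun A g" "smooth_fun A b"
    for v f a g b
    using tangent_add[OF that(1) smooth_fun_mult[OF that(2,3)] smooth_fun_mult[OF that(4,5)]]
      tangent_mult[OF that(1-3)] tangent_mult[OF that(1,4,5)]
    by (simp add: plus_fun_def times_fun_def)
  have 1: "lie_bracket A X Y x (f + g) = lie_bracket A X Y x f + lie_bracket A X Y x g"
    if "smooth_fun A f" "smooth_fun A g" for f g
    using that by (simp add: lie_bracket_def smooth_fun_add add X Y s
      tangent_add[OF t(1), unfolded plus_fun_def] tangent_add[OF t(2), unfolded plus_fun_def])
  have 2: "lie_bracket A X Y x (f * g) = f x * lie_bracket A X Y x g + g x * lie_bracket A X Y x f"
    if "smooth_fun A f" "smooth_fun A g" for f g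
    using that by (simp add: lie_bracket_def smooth_fun_mult mult X Y s
      leibniz[OF t(1)] leibniz[OF t(2)] algebra_simps)
  have 3: "lie_bracket A X Y x (c *\<^sub>R f) = c * lie_bracket A X Y x f"
    if "smooth_fun A f" for f c
    using that by (simp add: lie_bracket_def smooth_fun_scaleR sc X Y
      tangent_scaleR[OF t(1)] tangent_scaleR[OF t(2)] tangent_scaleR[OF t(1), unfolded scaleR_fun_def real_scaleR_def]
      tangent_scaleR[OF t(2), unfolded scaleR_fun_def real_scaleR_def] s algebra_simps)
  show ?thesis
    using 1 2 3 by (simp add: tangent_space_def lie_bracket_def)
qed

lemma smooth_vector_field_lie_bracket:
  assumes X: "smooth_vector_field A X" and Y: "smooth_vector_field A Y"
  shows "smooth_vector_field A (lie_bracket A X Y)"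
proof -
  have "smooth_fun A (\<lambda>x. lie_bracket A X Y x f)" if "smooth_fun A f" for f
    using smooth_fun_diff[OF smooth_vector_field_smooth[OF X smooth_vector_field_smooth[OF Y that]]
      smooth_vector_field_smooth[OF Y smooth_vector_field_smooth[OF X that]]] that
    by (simp add: lie_bracket_def fun_diff_def)
  then show ?thesis
    using lie_bracket_tangent[OF X Y] by (auto simp: smooth_vector_field_def)
qed

lemma lie_bracket_add_left:
  assumes "smooth_vector_field A X" "smooth_vector_field A X'" "smooth_vector_field A Y"
  shows "lie_bracket A (X + X') Y = lie_bracket A X Y + lie_bracket A X' Y"
proof -
  have "Y x (\<lambda>y. X y f + X' y f) = Y x (\<lambda>y. X y f) + Y x (\<lambda>y. X' y f)" if "smooth_fun A f" for x f
    using tangent_add[OF smooth_vector_field_tangent[OF assms(3)]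
      smooth_vector_field_smooth[OF assms(1) that] smooth_vector_field_smooth[OF assms(2) that]]
    by (simp add: plus_fun_def)
  then show ?thesis by (auto simp: lie_bracket_def fun_eq_iff)
qed

lemma lie_bracket_scaleR_left:
  assumes "smooth_vector_field A X" "smooth_vector_field A Y"
  shows "lie_bracket A (c *\<^sub>R X) Y = c *\<^sub>R lie_bracket A X Y"
proof -
  have "Y x (\<lambda>y. c * X y f) = c * Y x (\<lambda>y. X y f)" if "smooth_fun A f" for x f
    using tangent_scaleR[OF smooth_vector_field_tangent[OF assms(2)]
      smooth_vector_field_smooth[OF assms(1) that]]
    by (simp add: scaleR_fun_def)
  then show ?thesis by (auto simp: lie_bracket_def fun_eq_iff scaleR_fun_def algebra_simps)
qed

lemma lie_bracket_zero_left: "smooth_vector_field A Y \<Longrightarrow> lie_bracket A 0 Y = 0"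
  using lie_bracket_scaleR_left[OF smooth_vector_field_zero, of Y 0] by simp

lemma lie_bracket_commute: "lie_bracket A X Y = - lie_bracket A Y X"
  by (auto simp: lie_bracket_def fun_eq_iff)

section \<open>The Lie algebra of left-invariant fields, its center and its commutator ideal\<close>

lemma lie_algebra_smooth: "X \<in> lie_algebra A mul \<Longrightarrow> smooth_vector_field A X"
  by (simp add: lie_algebra_def)

lemma subspace_lie_algebra: "subspace (lie_algebra A mul)"
proof -
  have scale: "(c *\<^sub>R X) x = c *\<^sub>R X x" for c x and X :: "'m vfield"
    by (simp add: scaleR_fun_def)
  \<comment> \<open>\<open>push_forward\<close> is linear in the vector, so left-invariance is a
    linear condition on the field.\<close>
  have "push_forward A F 0 = 0"
      "push_forward A F (v + w) = push_forward A F v + push_forward A F w"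
      "push_forward A F (c *\<^sub>R v) = c *\<^sub>R push_forward A F v" for F c and v w :: "'m tvec"
    by (auto simp: push_forward_def fun_eq_iff scaleR_fun_def)
  then show ?thesis
    by (intro subspaceI) (simp_all add: lie_algebra_def smooth_vector_field_zero
      smooth_vector_field_add smooth_vector_field_scaleR scale)
qed

text \<open>Whether \<open>f \<circ> mul a\<close> is smooth is irrelevant: otherwise \<open>X\<close> and \<open>Y\<close> annihilate it by
  the normalisation of tangent vectors, and both sides vanish.\<close>

lemma lie_bracket_in_lie_algebra:
  assumes X: "X \<in> lie_algebra A mul" and Y: "Y \<in> lie_algebra A mul"
  shows "lie_bracket A X Y \<in> lie_algebra A mul"
proof -
  note sX = lie_algebra_smooth[OF X] and sY = lie_algebra_smooth[OF Y]
  have inv: "Z x (f \<circ> mul a) = Z (mul a x) f"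
    if "Z \<in> lie_algebra A mul" "smooth_fun A f" for Z x f a
  proof -
    have "push_forward A (mul a) (Z x) f = Z (mul a x) f"
      using that(1) by (simp add: lie_algebra_def)
    then show ?thesis using that(2) by (simp add: push_forward_def)
  qed
  \<comment> \<open>Two uses of \<open>inv\<close>: for \<open>Z'\<close> it turns the inner
    function into the derivative of \<open>f\<close> along \<open>Z'\<close>, composed with
    \<open>mul a\<close>; that derivative is again smooth, so \<open>inv\<close> applies to
    \<open>Z\<close>.\<close>
  have inv2: "Z x (\<lambda>y. Z' y (f \<circ> mul a)) = Z (mul a x) (\<lambda>y. Z' y f)"
    if "Z \<in> lie_algebra A mul" "Z' \<in> lie_algebra A mul" "smooth_fun A f" for Z Z' x f a
  proof -
    have "(\<lambda>y. Z' y (f \<circ> mul a)) = (\<lambda>y. Z' y f) \<circ> mul a"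
      using inv[OF that(2,3)] by auto
    then show ?thesis
      using inv[OF that(1) smooth_vector_field_smooth[OF lie_algebra_smooth[OF that(2)] that(3)]]
      by simp
  qed
  have "push_forward A (mul a) (lie_bracket A X Y x) f = lie_bracket A X Y (mul a x) f" for a x f
  proof (cases "smooth_fun A f")
    case f: True
    have "lie_bracket A X Y x (f \<circ> mul a)
        = X x (\<lambda>y. Y y (f \<circ> mul a)) - Y x (\<lambda>y. X y (f \<circ> mul a))"
    proof (cases "smooth_fun A (f \<circ> mul a)")
      case False
      then have "(\<lambda>y. Z y (f \<circ> mul a)) = 0" if "smooth_vector_field A Z" for Z
        using tangent_nonsmooth[OF smooth_vector_field_tangent[OF that]] by auto
      then show ?thesis
        using False sX sY tangent_const[OF smooth_vector_field_tangent[OF sX]]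
          tangent_const[OF smooth_vector_field_tangent[OF sY]]
        by (simp add: lie_bracket_def zero_fun_def)
    qed (simp add: lie_bracket_def)
    then show ?thesis
      using f by (simp add: push_forward_def inv2 X Y) (simp add: lie_bracket_def)
  qed (simp add: push_forward_def lie_bracket_def)
  then show ?thesis
    using smooth_vector_field_lie_bracket[OF sX sY] by (auto simp: lie_algebra_def)
qed

lemma subspace_lie_center: "subspace (lie_center A mul)"
proof (rule subspaceI)
  show "0 \<in> lie_center A mul"
    by (auto simp: lie_center_def subspace_0[OF subspace_lie_algebra] lie_bracket_zero_left
      lie_algebra_smooth)
next
  fix X Y assume "X \<in> lie_center A mul" "Y \<in> lie_center A mul"
  then show "X + Y \<in> lie_center A mul"
    by (auto simp: lie_center_def subspace_add[OF subspace_lie_algebra] lie_bracket_add_left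
      lie_algebra_smooth)
next
  fix X c assume "X \<in> lie_center A mul"
  then show "c *\<^sub>R X \<in> lie_center A mul"
    by (auto simp: lie_center_def subspace_scale[OF subspace_lie_algebra] lie_bracket_scaleR_left
      lie_algebra_smooth)
qed

lemma commutator_ideal_subset: "commutator_ideal A mul \<subseteq> lie_algebra A mul"
  unfolding commutator_ideal_def
  by (rule span_minimal[OF _ subspace_lie_algebra]) (auto simp: lie_bracket_in_lie_algebra)

end

section \<open>Isotropic vectors and the index of a form\<close>

text \<open>The functionals are the coordinates of an injective linear map from \<open>V\<close>
  into the functions on \<open>I\<close>, whose image lies in the span of at most
  \<open>card I\<close> unit vectors.\<close>

lemma dim_le_card_separating:
  fixes V :: "'v::real_vector set" and \<phi> :: "'i \<Rightarrow> 'v \<Rightarrow> real"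
  assumes V: "subspace V" and fin: "finite I"
    and add: "\<And>i u v. i \<in> I \<Longrightarrow> u \<in> V \<Longrightarrow> v \<in> V \<Longrightarrow> \<phi> i (u + v) = \<phi> i u + \<phi> i v"
    and scale: "\<And>i c v. i \<in> I \<Longrightarrow> v \<in> V \<Longrightarrow> \<phi> i (c *\<^sub>R v) = c * \<phi> i v"
    and sep: "\<And>v. v \<in> V \<Longrightarrow> (\<And>i. i \<in> I \<Longrightarrow> \<phi> i v = 0) \<Longrightarrow> v = 0"
  shows "dim V \<le> card I"
proof -
  obtain B where B: "B \<subseteq> V" "independent B" "V \<subseteq> span B" "card B = dim V"
    using basis_exists .
  then have VB: "V = span B" using V by (simp add: span_minimal subset_antisym)
  \<comment> \<open>The coordinate map, linear only on \<open>V\<close>. The padding by 0 off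
    \<open>I\<close> keeps its values in the span of the unit vectors \<open>\<delta> i\<close> with
    \<open>i\<close> in \<open>I\<close>.\<close>
  define F where "F v = (\<lambda>i. if i \<in> I then \<phi> i v else 0)" for v
  define \<delta> where "\<delta> i = (\<lambda>j. if j = i then 1 else 0 :: real)" for i :: 'i
  \<comment> \<open>A map linear on the whole space that agrees with \<open>F\<close> on the basis,
    as the facts on images of independent sets ask for global linearity.\<close>
  obtain T where T: "linear T" "\<And>b. b \<in> B \<Longrightarrow> T b = F b"
    using linear_independent_extend[OF B(2)] by blast
  have zero: "\<phi> i 0 = 0" if "i \<in> I" for i
    using scale[OF that subspace_0[OF V], of 0] by simp
  have TF: "T v = F v" if "v \<in> V" for v
  proof -
    have "v \<in> span B" using that VB by simp
    \<comment> \<open>Membership in \<open>V\<close> is carried through the induction because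
      \<open>add\<close> and \<open>scale\<close> hold only there.\<close>
    then have "v \<in> V \<and> T v = F v"
    proof (induction rule: span_induct_alt)
      case base
      then show ?case using linear_0[OF T(1)] zero subspace_0[OF V] by (auto simp: F_def)
    next
      case (step c x y)
      then have inV: "x \<in> V" "c *\<^sub>R x \<in> V" "y \<in> V"
        using B(1) V by (auto intro: subspace_scale)
      then have "F (c *\<^sub>R x + y) = c *\<^sub>R F x + F y"
        by (auto simp: F_def add scale scaleR_fun_def)
      then show ?case
        using step T inV V by (simp add: linear_add linear_scale subspace_add)
    qed
    then show ?thesis by blast
  qed
  have "inj_on T (span B)"
  proof (rule linear_injective_on_subspace_0[THEN iffD2, OF T(1)])
    show "\<forall>x\<in>span B. T x = 0 \<longrightarrow> x = 0"
    proof (intro ballI impI)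
      fix v assume "v \<in> span B" "T v = 0"
      then have "v \<in> V" "F v = 0" using TF VB by auto
      then show "v = 0" by (intro sep) (auto simp: F_def fun_eq_iff split: if_splits)
    qed
  qed simp
  then have ind: "independent (T ` B)" and inj: "inj_on T B"
    using linear_independent_injective_image[OF T(1) B(2)] inj_on_subset[OF _ span_superset] by auto
  have "F v \<in> span (\<delta> ` I)" for v
  proof -
    have "(\<Sum>i\<in>I. \<phi> i v *\<^sub>R \<delta> i) x = (\<Sum>i\<in>I. \<phi> i v * \<delta> i x)" for x
      using fin by (induction I rule: finite_induct) (auto simp: scaleR_fun_def)
    then have "F v = (\<Sum>i\<in>I. \<phi> i v *\<^sub>R \<delta> i)"
      using fin by (auto simp: F_def fun_eq_iff \<delta>_def if_distrib[of "(*) _"] cong: if_cong)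
    then show ?thesis by (auto intro: span_sum span_scale span_base)
  qed
  then have "T ` B \<subseteq> span (\<delta> ` I)" using T(2) by auto
  then have "card (T ` B) \<le> card (\<delta> ` I)"
    using independent_span_bound[OF finite_imageI[OF fin] ind] by blast
  then show "dim V \<le> card I"
    using card_image[OF inj] card_image_le[OF fin, of \<delta>] B(4) by linarith
qed

lemma nondegenerate_symmetric_form_onD:
  assumes "nondegenerate_symmetric_form_on T b"
  shows form_on_sym: "u \<in> T \<Longrightarrow> v \<in> T \<Longrightarrow> b u v = b v u"
    and form_on_add: "u \<in> T \<Longrightarrow> v \<in> T \<Longrightarrow> w \<in> T \<Longrightarrow> b (u + v) w = b u w + b v w"
    and form_on_scaleR: "u \<in> T \<Longrightarrow> w \<in> T \<Longrightarrow> b (c *\<^sub>R u) w = c * b u w"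
  using assms by (simp_all add: nondegenerate_symmetric_form_on_def)

lemma form_on_zero:
  assumes "nondegenerate_symmetric_form_on T b" "w \<in> T"
  shows "b 0 w = 0"
  using form_on_scaleR[OF assms(1,2,2), of 0] by simp

text \<open>The negative basis vectors \<open>N\<close>, together with \<open>C\<close>, separate \<open>V\<close>: a vector orthogonal to
  \<open>N\<close> lies in the positive definite span of \<open>P\<close>.\<close>

lemma dim_le_negative_index:
  fixes V :: "'u::real_vector set" and T :: "'v::real_vector set" and E :: "'u \<Rightarrow> 'v"
  assumes T: "subspace T" and b: "nondegenerate_symmetric_form_on T b"
    and sig: "has_signature_on T b p q"
    and V: "subspace V" and E: "linear E" and EV: "E ` V \<subseteq> T"
    and inj: "\<And>v. v \<in> V \<Longrightarrow> E v = 0 \<Longrightarrow> v = 0"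
    and C: "finite C" "C \<subseteq> T"
    and iso: "\<And>v. v \<in> V \<Longrightarrow> (\<And>c. c \<in> C \<Longrightarrow> b c (E v) = 0) \<Longrightarrow> b (E v) (E v) = 0"
  shows "dim V \<le> card C + q"
proof -
  note sym = form_on_sym[OF b] and addl = form_on_add[OF b] and scl = form_on_scaleR[OF b]
    and zl = form_on_zero[OF b]
  have addr: "b w (u + v) = b w u + b w v" if "u \<in> T" "v \<in> T" "w \<in> T" for u v w
    using addl[OF that] sym that subspace_add[OF T] by metis
  have scr: "b w (c *\<^sub>R u) = c * b w u" if "u \<in> T" "w \<in> T" for c u w
    using scl[OF that] sym that subspace_scale[OF T] by metis
  have zl: "b 0 w = 0" if "w \<in> T" for w
    using scl[OF subspace_0[OF T] that, of 0] by simp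
  obtain P N where PN: "finite P" "finite N" "P \<inter> N = {}" "card N = q"
      "P \<union> N \<subseteq> T" "T \<subseteq> span (P \<union> N)" "pairwise (\<lambda>u v. b u v = 0) (P \<union> N)"
    and P: "\<And>u. u \<in> P \<Longrightarrow> b u u > 0" and N: "\<And>u. u \<in> N \<Longrightarrow> b u u < 0"
    using sig unfolding has_signature_on_def by blast
  have suml: "b (\<Sum>a\<in>S. u a *\<^sub>R a) w = (\<Sum>a\<in>S. u a * b a w)" if "S \<subseteq> T" "finite S" "w \<in> T" for S u w
    using that(2,1)
  proof (induction S rule: finite_induct)
    case empty
    then show ?case using zl that by (simp del: zero_fun_apply)
  next
    case (insert x S)
    then have "(\<Sum>a\<in>S. u a *\<^sub>R a) \<in> T" "u x *\<^sub>R x \<in> T"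
      by (auto intro!: subspace_sum[OF T] subspace_scale[OF T])
    then show ?case using insert addl scl that by simp
  qed
  \<comment> \<open>The separation property. Vanishing against \<open>N\<close> kills the negative
    coefficients, vanishing against \<open>C\<close> makes \<open>E v\<close> null, and positivity
    on \<open>P\<close> then kills the remaining coefficients.\<close>
  have ker: "v = 0" if v: "v \<in> V" and vN: "\<And>d. d \<in> N \<union> C \<Longrightarrow> b d (E v) = 0" for v
  proof -
    have w: "E v \<in> T" using EV v by auto
    then have "E v \<in> span (P \<union> N)" using PN by auto
    then obtain u where u: "E v = (\<Sum>a\<in>P \<union> N. u a *\<^sub>R a)"
      using span_finite[of "P \<union> N"] PN(1,2) by auto
    \<comment> \<open>The basis is orthogonal, so pairing with \<open>d\<close> reads off the
      coefficient \<open>u d\<close> up to the nonzero factor \<open>b d d\<close>.\<close>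
    have coeff: "b d (E v) = u d * b d d" if d: "d \<in> P \<union> N" for d
    proof -
      have dT: "d \<in> T" using d PN by auto
      have "b d (E v) = b (E v) d" using sym w dT by simp
      also have "\<dots> = (\<Sum>a\<in>P \<union> N. u a * b a d)"
        unfolding u using PN dT by (intro suml) auto
      also have "\<dots> = (\<Sum>a\<in>P \<union> N. if a = d then u d * b d d else 0)"
        using PN(7) d by (intro sum.cong) (auto simp: pairwise_def)
      also have "\<dots> = u d * b d d" using d PN by (simp add: sum.delta)
      finally show ?thesis .
    qed
    have uN: "u d = 0" if "d \<in> N" for d
      using coeff[of d] vN[of d] N[of d] that by auto
    have "b (E v) (E v) = (\<Sum>a\<in>P \<union> N. u a * b a (E v))"
      using suml[of "P \<union> N" "E v" u] u PN w by simp
    also have "\<dots> = (\<Sum>a\<in>P \<union> N. (u a)\<^sup>2 * b a a)"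
      using coeff by (intro sum.cong) (auto simp: power2_eq_square)
    also have "\<dots> = (\<Sum>a\<in>P. (u a)\<^sup>2 * b a a)"
      using PN uN by (intro sum.mono_neutral_right) auto
    finally have "(\<Sum>a\<in>P. (u a)\<^sup>2 * b a a) = 0"
      using iso[OF v] vN by simp
    then have "(u a)\<^sup>2 * b a a = 0" if "a \<in> P" for a
      using that PN(1) P by (subst (asm) sum_nonneg_eq_0_iff) (auto simp: less_imp_le)
    then have "u a = 0" if "a \<in> P" for a
      using that P by force
    then have "E v = 0" unfolding u using uN by (intro sum.neutral) auto
    then show ?thesis using inj v by blast
  qed
  have D: "finite (N \<union> C)" "N \<union> C \<subseteq> T" using PN C by auto
  have add: "b d (E (u + v)) = b d (E u) + b d (E v)" if "d \<in> N \<union> C" "u \<in> V" "v \<in> V" for d u v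
    using that D EV by (subst linear_add[OF E], intro addr) auto
  have scale: "b d (E (c *\<^sub>R v)) = c * b d (E v)" if "d \<in> N \<union> C" "v \<in> V" for d c v
    using that D EV by (subst linear_scale[OF E], intro scr) auto
  \<comment> \<open>One functional for each vector of \<open>N\<close> and \<open>C\<close>; the two
    sets may overlap, so the cardinality of the union is only bounded by the sum.\<close>
  have "dim V \<le> card (N \<union> C)"
    by (rule dim_le_card_separating[of V "N \<union> C" "\<lambda>d v. b d (E v)", OF V D(1) add scale ker])
  then show "dim V \<le> card C + q" using card_Un_le[of N C] PN(4) by simp
qed

lemma has_signature_on_uminus:
  assumes "has_signature_on T b p q"
  shows "has_signature_on T (\<lambda>u v. - b u v) q p"
proof -
  obtain P N where "finite P" "finite N" "P \<inter> N = {}" "card P = p" "card N = q"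
      "P \<union> N \<subseteq> T" "independent (P \<union> N)" "T \<subseteq> span (P \<union> N)" "pairwise (\<lambda>u v. b u v = 0) (P \<union> N)"
      "\<forall>u\<in>P. b u u > 0" "\<forall>u\<in>N. b u u < 0"
    using assms unfolding has_signature_on_def by blast
  then show ?thesis
    unfolding has_signature_on_def
    by (intro exI[of _ N] exI[of _ P]) (auto simp: Un_commute Int_commute)
qed

text \<open>The previous bound is applied to \<open>b\<close> and to its negative, which exchanges
  \<open>p\<close> and \<open>q\<close>. The set \<open>C\<close> allows for spaces whose vectors
  become null only after \<open>card C\<close> linear conditions; \<open>E\<close> allows
  \<open>V\<close> to consist of fields while the form lives on one tangent space.\<close>

lemma dim_le_index:
  fixes V :: "'u::real_vector set" and T :: "'v::real_vector set" and E :: "'u \<Rightarrow> 'v"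
  assumes T: "subspace T" and b: "nondegenerate_symmetric_form_on T b"
    and sig: "has_signature_on T b p q"
    and V: "subspace V" and E: "linear E" and EV: "E ` V \<subseteq> T"
    and inj: "\<And>v. v \<in> V \<Longrightarrow> E v = 0 \<Longrightarrow> v = 0"
    and C: "finite C" "C \<subseteq> T"
    and iso: "\<And>v. v \<in> V \<Longrightarrow> (\<And>c. c \<in> C \<Longrightarrow> b c (E v) = 0) \<Longrightarrow> b (E v) (E v) = 0"
  shows "dim V \<le> card C + min p q"
proof -
  have b': "nondegenerate_symmetric_form_on T (\<lambda>u v. - b u v)"
    using b by (simp add: nondegenerate_symmetric_form_on_def)
  have "dim V \<le> card C + q"
    by (rule dim_le_negative_index[OF T b sig V E EV inj C iso])
  moreover have "dim V \<le> card C + p"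
    by (rule dim_le_negative_index[OF T b' has_signature_on_uminus[OF sig] V E EV inj C])
      (use iso in auto)
  ultimately show ?thesis by simp
qed

section \<open>Dimension bounds for the center and the commutator ideal\<close>

theorem theorem1p2:
  fixes A :: "('g::{t2_space,second_countable_topology}, 'e::euclidean_space) atlas"
    and mul :: "'g \<Rightarrow> 'g \<Rightarrow> 'g" and e :: 'g and iv :: "'g \<Rightarrow> 'g"
    and h :: "'g metric_tensor" and n p q :: nat
  assumes "lie_group A mul e iv" and "DIM('e) = n"
    and "\<not> unimodular A mul"
    and "pseudo_riemannian_metric A h" and "metric_signature A h p q" and "p + q = n"
    and "left_invariant_metric A mul h"
    and "\<exists>X\<in>lie_algebra A mul. conformal_field A h X \<and> \<not> killing_field A h X"
  shows "dim (lie_center A mul) \<le> min p q \<and>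
    int (dim (commutator_ideal A mul)) \<ge> int (dim (lie_algebra A mul)) - int (min p q)"
proof -
  interpret grp: group mul e iv using assms(1) by (simp add: lie_group_def)
  interpret atlas A using assms(1) by unfold_locales (simp add: lie_group_def)
  let ?g = "lie_algebra A mul"
  obtain X \<rho> where X: "X \<in> ?g" "smooth_vector_field A X" and nk: "\<not> killing_field A h X"
    and \<rho>: "\<And>Y Z x. smooth_vector_field A Y \<Longrightarrow> smooth_vector_field A Z \<Longrightarrow>
      lie_derivative_metric A h X Y Z x = 2 * \<rho> x * h x (Y x) (Z x)"
    using assms(8) unfolding conformal_field_def by blast
  \<comment> \<open>If \<rho> vanished everywhere, the conformal equation would be the Killing
    equation.\<close>
  obtain x0 where x0: "\<rho> x0 \<noteq> 0"
    using nk \<rho> X(2) unfolding killing_field_def by fastforce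
  let ?T = "tangent_space A x0" and ?b = "h x0" and ?E = "\<lambda>Y :: 'g vfield. Y x0"
  have b: "nondegenerate_symmetric_form_on ?T ?b"
    using assms(4) by (simp add: pseudo_riemannian_metric_def)
  have sig: "has_signature_on ?T ?b p q" using assms(5) by (simp add: metric_signature_def)
  have E: "linear ?E" by (rule linearI) (auto simp: scaleR_fun_def)
  have gT: "Y x0 \<in> ?T" if "Y \<in> ?g" for Y
    using smooth_vector_field_tangent[OF lie_algebra_smooth[OF that]] .
  \<comment> \<open>Left translation by \<open>mul y (iv x0)\<close> carries \<open>x0\<close> to
    \<open>y\<close>, so the value at \<open>x0\<close> determines a left-invariant field.\<close>
  have inj: "Y = 0" if "Y \<in> ?g" "Y x0 = 0" for Y
  proof
    fix y
    have "Y (mul (mul y (iv x0)) x0) = push_forward A (mul (mul y (iv x0))) (Y x0)"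
      using that(1) by (simp add: lie_algebra_def)
    then show "Y y = 0 y"
      using that(2) by (simp add: grp.assoc push_forward_def fun_eq_iff)
  qed
  note sym = form_on_sym[OF b] and zl = form_on_zero[OF b]
  have iso: "?b (Y x0) (Y x0) = 0"
    if Y: "Y \<in> ?g" and orth: "?b (lie_bracket A X Y x0) (Y x0) = 0" for Y
  proof -
    \<comment> \<open>Left translation by \<open>y\<close> is an isometry carrying \<open>e\<close>
      to \<open>y\<close> and \<open>Y e\<close> to \<open>Y y\<close>.\<close>
    have "h y (Y y) (Y y) = h e (Y e) (Y e)" for y
    proof -
      have "metric_isometry A h (mul y)" using assms(7) by (simp add: left_invariant_metric_def)
      then have "h (mul y e) (push_forward A (mul y) (Y e)) (push_forward A (mul y) (Y e))
          = h e (Y e) (Y e)"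
        using smooth_vector_field_tangent[OF lie_algebra_smooth[OF Y]]
        unfolding metric_isometry_def by blast
      moreover have "push_forward A (mul y) (Y e) = Y (mul y e)"
        using Y by (simp add: lie_algebra_def)
      ultimately show ?thesis by simp
    qed
    then have "(\<lambda>y. h y (Y y) (Y y)) = (\<lambda>_. h e (Y e) (Y e))" by (rule ext)
    then have "X x0 (\<lambda>y. h y (Y y) (Y y)) = 0"
      using tangent_const[OF gT[OF X(1)]] by simp
    \<comment> \<open>With both arguments equal to \<open>Y\<close>, the two bracket terms agree by
      symmetry, and \<open>orth\<close> removes both.\<close>
    then have "lie_derivative_metric A h X Y Y x0 = 0"
      using orth sym[OF gT[OF Y] gT[OF lie_bracket_in_lie_algebra[OF X(1) Y]]]
      by (simp add: lie_derivative_metric_def)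
    then show ?thesis using \<rho>[OF lie_algebra_smooth[OF Y] lie_algebra_smooth[OF Y]] x0 by simp
  qed
  note dim_le = dim_le_index[OF subspace_tangent_space b sig _ E]
  \<comment> \<open>Here \<open>C\<close> is empty: central fields are null at \<open>x0\<close>
    without further conditions.\<close>
  have "dim (lie_center A mul) \<le> card ({} :: 'g tvec set) + min p q"
  proof (rule dim_le)
    fix Y assume Y: "Y \<in> lie_center A mul"
    then have "Y \<in> ?g" "lie_bracket A Y X = 0" using X by (auto simp: lie_center_def)
    \<comment> \<open>\<open>lie_center\<close> puts the central field first in the bracket,
      \<open>iso\<close> puts \<open>X\<close> first.\<close>
    then have "?b (lie_bracket A X Y x0) (Y x0) = 0"
      using lie_bracket_commute[of X Y] zl gT by simp
    then show "?b (Y x0) (Y x0) = 0" using iso \<open>Y \<in> ?g\<close> by blast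
  qed (use gT inj subspace_lie_center in \<open>auto simp: lie_center_def\<close>)
  moreover have "dim ?g \<le> dim (commutator_ideal A mul) + min p q"
  proof -
    \<comment> \<open>The two halves of an orthogonal basis together span the tangent space. This
      finite set is what bounds the basis \<open>C\<close> of the commutator ideal: evaluation at
      \<open>x0\<close> embeds \<open>C\<close> as an independent set in its span.\<close>
    obtain P where P: "finite P" "?T \<subseteq> span P"
      using sig unfolding has_signature_on_def by (metis finite_UnI)
    obtain C where C: "C \<subseteq> commutator_ideal A mul" "independent C"
        "commutator_ideal A mul \<subseteq> span C" "card C = dim (commutator_ideal A mul)"
      using basis_exists .
    have Cg: "span C \<subseteq> ?g"
      using C(1) commutator_ideal_subset by (intro span_minimal subspace_lie_algebra) blast
    have injC: "inj_on ?E (span C)"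
      using Cg inj by (subst linear_injective_on_subspace_0[OF E]) auto
    have "?E ` C \<subseteq> span P"
      using Cg span_superset[of C] gT P(2) by blast
    then have "finite (?E ` C)"
      using independent_span_bound[OF P(1) linear_independent_injective_image[OF E C(2) injC]] by blast
    then have fC: "finite C"
      using inj_on_subset[OF injC span_superset] finite_imageD by blast
    \<comment> \<open>Taking \<open>V\<close> to be the whole Lie algebra, the conditions express
      orthogonality at \<open>x0\<close> to a basis of the commutator ideal; no complement has to be
      constructed.\<close>
    have "dim ?g \<le> card (?E ` C) + min p q"
    proof (rule dim_le)
      show "?E ` C \<subseteq> ?T"
        using gT Cg span_superset[of C] by blast
    next
      fix Y assume Y: "Y \<in> ?g" and orth: "\<And>c. c \<in> ?E ` C \<Longrightarrow> ?b c (Y x0) = 0"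
      \<comment> \<open>Membership in \<open>span C\<close> is part of the induction so that the
        values at \<open>x0\<close> are known to be tangent vectors, where the form is
        additive.\<close>
      have orth_span: "Z \<in> span C \<and> ?b (Z x0) (Y x0) = 0" if "Z \<in> span C" for Z
        using that
      proof (induction rule: span_induct_alt)
        case base
        then show ?case using zl[OF gT[OF Y]] span_zero[of C] linear_0[OF E] by metis
      next
        case (step c Z Z')
        have T: "Z x0 \<in> ?T" "Z' x0 \<in> ?T" "c *\<^sub>R Z x0 \<in> ?T"
          using step Cg gT span_base subspace_scale[OF subspace_tangent_space] by blast+
        have "?b (c *\<^sub>R Z x0 + Z' x0) (Y x0) = c * ?b (Z x0) (Y x0) + ?b (Z' x0) (Y x0)"
          using form_on_add[OF b T(3,2) gT[OF Y]] form_on_scaleR[OF b T(1) gT[OF Y]] by simp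
        then have "?b ((c *\<^sub>R Z + Z') x0) (Y x0) = 0"
          using step orth by (simp add: linear_add[OF E] linear_scale[OF E])
        then show ?case
          using step by (blast intro: span_add span_scale span_base)
      qed
      \<comment> \<open>This bracket is a generator of the commutator ideal, so orthogonality of
        \<open>Y\<close> to \<open>C\<close> yields the hypothesis of \<open>iso\<close>.\<close>
      moreover have "lie_bracket A X Y \<in> span C"
        using C(3) X(1) Y unfolding commutator_ideal_def by (blast intro: span_base)
      ultimately show "?b (Y x0) (Y x0) = 0" using iso[OF Y] orth_span by blast
    qed (use gT inj subspace_lie_algebra fC in auto)
    then show ?thesis
      using card_image_le[OF fC, of ?E] C(4) by linarith
  qed
  ultimately show ?thesis by simp
qed

end
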